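(* Let $S_a$ be the linear univariate binary subdivision scheme with mask $\mathbf{a}$ and let $\{S_a\circ M^k\}$ be the PN subdivision scheme generalizing $S_a$. If $S_a\in C^0$, then $\{S_a\circ M^k\}\approx S_a$ (asymptotic equivalence) and $\{S_a\circ M^k\}$ converges.
   Context: Linear scheme: $\mathbf{a}=\{a_i\}_{i\in\mathbb{Z}}$ is a finitely supported real mask with $\sum_j a_{2j}=\sum_j a_{2j+1}=1$; $S_a=(a_{i-2j})_{i,j\in\mathbb{Z}}$ maps $P^k=(\mathbf{p}_j^k)_{j\in\mathbb{Z}}$ to $P^{k+1}=S_aP^k$. A scheme is convergent (in $C^0$) if, for bounded initial data, the piecewise linear curves interpolating $\mathbf{p}_i^k$ at the knots $2^{-k}i$ converge uniformly as $k\to\infty$. Normals: from initial unit normals $\mathbf{n}_i^0$ (on the unit circle or sphere), $\mathbf{n}_i^{k+1}=\sum_j a_{i-2j}\mathbf{n}_j^k/\|\sum_j a_{i-2j}\mathbf{n}_j^k\|$. PN scheme: with $\mathbf{q}_i^{k+1}=\sum_j a_{i-2j}\mathbf{p}_j^k$, the new points are $\mathbf{p}_i^{k+1}=\mathbf{q}_i^{k+1}+\sum_j a_{i-2j}A_{ij}^k(\mathbf{p}_j^k-\mathbf{q}_i^{k+1})$, where $$A_{ij}^k=\frac{\mathbf{n}_i^{k+1}(\mathbf{n}_j^k+\mathbf{n}_i^{k+1})^\top}{(\mathbf{n}_j^k+\mathbf{n}_i^{k+1})^\top\mathbf{n}_i^{k+1}}.$$ Equivalently $\mathbf{p}_i^{k+1}=\sum_j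 a_{i-2j}M_{ij}^k\mathbf{p}_j^k$ with $M_{ij}^k=I+\sum_{l}a_{i-2l}(A_{ij}^k-A_{il}^k)$, i.e. $P^{k+1}=(S_a\circ M^k)P^k$, where $S_a\circ M^k=(a_{i-2j}M_{ij}^k)_{i,j\in\mathbb{Z}}$ is a bi-infinite block matrix. Asymptotic equivalence $\{S_a\circ M^k\}\approx S_a$ means $\sum_{k}\|S_a\circ M^k-S_a\|_\infty<+\infty$, where $S_a$ is identified with $(a_{i-2j}I)_{i,j}$ and $\|S_a\circ M^k-S_a\|_\infty=\sup_i\sum_j\|a_{i-2j}(M_{ij}^k-I)\|_\infty$. Standing assumptions: the initial normals are locally dense enough that all denominators above (those occurring with non-zero weights) are non-zero, understood uniformly, i.e. bounded away from zero. Under $S_a\in C^0$, the projected normals have, as known from the literature, the same smoothness and H\"older regularity as $S_a$: there are constants $c_1>0$, $0<\alpha\le 1$ with $\|\mathbf{n}_i^k-\mathbf{n}_{i-1}^k\|<c_1 2^{-k\alpha}$ for all $i,k$. *)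

theory Defs
  imports "HOL-Analysis.Analysis"
begin

definition is_mask :: "(int \<Rightarrow> real) \<Rightarrow> bool" where
  "is_mask a \<longleftrightarrow> finite {i. a i \<noteq> 0} \<and>
     (\<Sum>j | a (2 * j) \<noteq> 0. a (2 * j)) = 1 \<and>
     (\<Sum>j | a (2 * j + 1) \<noteq> 0. a (2 * j + 1)) = 1"

text \<open>For a finitely supported mask the index sets \<open>{j. a (i - 2 * j) \<noteq> 0}\<close> below are finite,
  so the sums over them are the full sums over all integers \<open>j\<close>.\<close>

definition subdiv :: "(int \<Rightarrow> real) \<Rightarrow> (int \<Rightarrow> 'v::real_vector) \<Rightarrow> int \<Rightarrow> 'v" where
  "subdiv a p i = (\<Sum>j | a (i - 2 * j) \<noteq> 0. a (i - 2 * j) *\<^sub>R p j)"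

primrec scheme_points ::
  "(nat \<Rightarrow> (int \<Rightarrow> 'v) \<Rightarrow> int \<Rightarrow> 'v) \<Rightarrow> (int \<Rightarrow> 'v) \<Rightarrow> nat \<Rightarrow> int \<Rightarrow> 'v" where
  "scheme_points T p 0 = p"
| "scheme_points T p (Suc k) = T k (scheme_points T p k)"

text \<open>The piecewise linear curve with value \<open>p i\<close> at the knot \<open>i / 2 ^ k\<close>.\<close>

definition polyline :: "nat \<Rightarrow> (int \<Rightarrow> 'v::real_vector) \<Rightarrow> real \<Rightarrow> 'v" where
  "polyline k p t =
     (1 - frac (2 ^ k * t)) *\<^sub>R p \<lfloor>2 ^ k * t\<rfloor> + frac (2 ^ k * t) *\<^sub>R p (\<lfloor>2 ^ k * t\<rfloor> + 1)"

definition C0_convergent ::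
  "(nat \<Rightarrow> (int \<Rightarrow> 'v::real_normed_vector) \<Rightarrow> int \<Rightarrow> 'v) \<Rightarrow> bool" where
  "C0_convergent T \<longleftrightarrow>
     (\<forall>p. bounded (range p) \<longrightarrow>
       (\<exists>f. uniform_limit UNIV (\<lambda>k. polyline k (scheme_points T p k)) f sequentially))"

definition mat_norm_inf :: "real^'n^'n \<Rightarrow> real" where
  "mat_norm_inf A = (MAX r. \<Sum>c\<in>UNIV. \<bar>A $ r $ c\<bar>)"

text \<open>The distance takes values in \<^typ>\<open>ennreal\<close>, so that an unbounded supremum is \<open>\<infinity>\<close>
  instead of an unspecified real.\<close>

definition block_dist :: "(int \<Rightarrow> int \<Rightarrow> real^'n^'n) \<Rightarrow> (int \<Rightarrow> int \<Rightarrow> real^'n^'n) \<Rightarrow> ennreal" where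
  "block_dist B C = (SUP i. \<Sum>\<^sub>\<infinity>j. ennreal (mat_norm_inf (B i j - C i j)))"

definition asymp_equivalent ::
  "(nat \<Rightarrow> int \<Rightarrow> int \<Rightarrow> real^'n^'n) \<Rightarrow> (int \<Rightarrow> int \<Rightarrow> real^'n^'n) \<Rightarrow> bool" where
  "asymp_equivalent B C \<longleftrightarrow> (\<Sum>k. block_dist (B k) C) < \<infinity>"

definition subdiv_block :: "(int \<Rightarrow> real) \<Rightarrow> int \<Rightarrow> int \<Rightarrow> real^'n^'n" where
  "subdiv_block a i j = a (i - 2 * j) *\<^sub>R mat 1"

primrec normals :: "(int \<Rightarrow> real) \<Rightarrow> (int \<Rightarrow> real^'n) \<Rightarrow> nat \<Rightarrow> int \<Rightarrow> real^'n" where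
  "normals a n0 0 = n0"
| "normals a n0 (Suc k) =
     (\<lambda>i. subdiv a (normals a n0 k) i /\<^sub>R norm (subdiv a (normals a n0 k) i))"

text \<open>The point-normal (PN) scheme: the matrix \<open>u (v + u)\<^sup>T / ((v + u)\<^sup>T u)\<close>, with \<open>u\<close> the new normal at
  \<open>i\<close> and \<open>v\<close> the old normal at \<open>j\<close>.  The level \<open>k\<close> of the normals is the one before refinement.
  Since the normals evolve independently of the points, the PN scheme with given initial normals is a
  level-dependent linear scheme for the points; it is the action of the block matrices \<open>pn_block\<close>
  (lemma \<open>pn_refine_eq_block\<close>).\<close>

definition pn_A :: "(int \<Rightarrow> real) \<Rightarrow> (int \<Rightarrow> real^'n) \<Rightarrow> nat \<Rightarrow> int \<Rightarrow> int \<Rightarrow> real^'n^'n" where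
  "pn_A a n0 k i j =
     (let u = normals a n0 (Suc k) i; v = normals a n0 k j
      in (\<chi> r c. u $ r * (v + u) $ c / ((v + u) \<bullet> u)))"

definition pn_refine ::
  "(int \<Rightarrow> real) \<Rightarrow> (int \<Rightarrow> real^'n) \<Rightarrow> nat \<Rightarrow> (int \<Rightarrow> real^'n) \<Rightarrow> int \<Rightarrow> real^'n" where
  "pn_refine a n0 k p i =
     (let q = subdiv a p i
      in q + (\<Sum>j | a (i - 2 * j) \<noteq> 0. a (i - 2 * j) *\<^sub>R (pn_A a n0 k i j *v (p j - q))))"

definition pn_M :: "(int \<Rightarrow> real) \<Rightarrow> (int \<Rightarrow> real^'n) \<Rightarrow> nat \<Rightarrow> int \<Rightarrow> int \<Rightarrow> real^'n^'n" where
  "pn_M a n0 k i j =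
     mat 1 + (\<Sum>l | a (i - 2 * l) \<noteq> 0. a (i - 2 * l) *\<^sub>R (pn_A a n0 k i j - pn_A a n0 k i l))"

definition pn_block :: "(int \<Rightarrow> real) \<Rightarrow> (int \<Rightarrow> real^'n) \<Rightarrow> nat \<Rightarrow> int \<Rightarrow> int \<Rightarrow> real^'n^'n" where
  "pn_block a n0 k i j = a (i - 2 * j) *\<^sub>R pn_M a n0 k i j"

text \<open>The denominators in the definitions of the normals and of the matrices \<^const>\<open>pn_A\<close>,
  as far as they occur with non-zero weight, are uniformly bounded away from zero.\<close>

definition pn_nondegenerate :: "(int \<Rightarrow> real) \<Rightarrow> (int \<Rightarrow> real^'n) \<Rightarrow> bool" where
  "pn_nondegenerate a n0 \<longleftrightarrow>
     (\<exists>\<delta>>0. \<forall>k i. norm (subdiv a (normals a n0 k) i) \<ge> \<delta> \<and>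
        (\<forall>j. a (i - 2 * j) \<noteq> 0 \<longrightarrow>
           \<bar>(normals a n0 k j + normals a n0 (Suc k) i) \<bullet> normals a n0 (Suc k) i\<bar> \<ge> \<delta>))"

lemma mask_row_sum:
  assumes "is_mask a"
  shows "(\<Sum>j | a (i - 2 * j) \<noteq> 0. a (i - 2 * j)) = 1"
proof (cases "even i")
  case True
  then obtain m where m: "i = 2 * m" by (auto elim: evenE)
  have "(\<Sum>j | a (i - 2 * j) \<noteq> 0. a (i - 2 * j)) = (\<Sum>j | a (2 * j) \<noteq> 0. a (2 * j))"
    by (rule sum.reindex_bij_witness[of _ "\<lambda>j. m - j" "\<lambda>j. m - j"]) (auto simp: m algebra_simps)
  then show ?thesis using assms by (simp add: is_mask_def)
next
  case False
  then obtain m where m: "i = 2 * m + 1" by (auto elim: oddE)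
  have "(\<Sum>j | a (i - 2 * j) \<noteq> 0. a (i - 2 * j)) = (\<Sum>j | a (2 * j + 1) \<noteq> 0. a (2 * j + 1))"
    by (rule sum.reindex_bij_witness[of _ "\<lambda>j. m - j" "\<lambda>j. m - j"]) (auto simp: m algebra_simps)
  then show ?thesis using assms by (simp add: is_mask_def)
qed

lemma sum_matrix_vector_mult:
  "(\<Sum>x\<in>S. f x) *v (v :: real^'n) = (\<Sum>x\<in>S. f x *v v)" for f :: "'b \<Rightarrow> real^'n^'m"
  by (induction S rule: infinite_finite_induct) (auto simp: matrix_vector_mult_add_rdistrib)

lemma pn_refine_eq_block:
  fixes p :: "int \<Rightarrow> real^'n"
  assumes "is_mask a"
  shows "pn_refine a n0 k p i = (\<Sum>j | a (i - 2 * j) \<noteq> 0. pn_block a n0 k i j *v p j)"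
proof -
  let ?S = "{j. a (i - 2 * j) \<noteq> 0}"
  let ?w = "\<lambda>j. a (i - 2 * j)"
  let ?A = "pn_A a n0 k i"
  define q where "q = subdiv a p i"
  define B where "B = (\<Sum>l\<in>?S. ?w l *\<^sub>R ?A l)"
  have 1: "(\<Sum>l\<in>?S. ?w l) = 1" by (rule mask_row_sum[OF assms])
  have M: "pn_M a n0 k i j = mat 1 + (?A j - B)" for j
    using 1 by (simp add: pn_M_def B_def scaleR_diff_right sum_subtractf
        flip: scaleR_sum_left)
  have "(\<Sum>j\<in>?S. pn_block a n0 k i j *v p j) =
      (\<Sum>j\<in>?S. ?w j *\<^sub>R p j + (?w j *\<^sub>R (?A j *v p j) - B *v (?w j *\<^sub>R p j)))"
    by (rule sum.cong) (auto simp: pn_block_def M matrix_vector_mult_add_rdistrib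
        matrix_vector_mult_diff_rdistrib scaleR_matrix_vector_assoc[symmetric]
        matrix_vector_mult_scaleR scaleR_add_right scaleR_diff_right)
  also have "\<dots> = q + ((\<Sum>j\<in>?S. ?w j *\<^sub>R (?A j *v p j)) - B *v q)"
    by (simp add: sum.distrib sum_subtractf q_def subdiv_def
        linear_sum[OF matrix_vector_mul_linear])
  also have "B *v q = (\<Sum>j\<in>?S. ?w j *\<^sub>R (?A j *v q))"
    by (simp add: B_def sum_matrix_vector_mult scaleR_matrix_vector_assoc)
  finally show ?thesis
    by (simp add: pn_refine_def Let_def q_def matrix_vector_mult_diff_distrib
        scaleR_diff_right sum_subtractf)
qed

end

theory Submission
  imports Defs
begin

text \<open>Normals at distance at most \<open>N\<close> in index differ by \<open>O(\<theta>\<^sup>k)\<close> with \<open>\<theta> = 2\<^sup>-\<^sup>\<alpha> < 1\<close>, hence so do the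
  matrices \<open>A\<close> within one row, and \<open>M - I\<close> is \<open>O(\<theta>\<^sup>k)\<close>, which is summable.

  For the convergence, write \<open>S\<close> for the linear scheme and \<open>\<epsilon>\<^sub>k\<close> for the distance of the perturbed
  operator from \<open>S\<close>.  Convergence for the delta sequence bounds the basis sequences \<open>S\<^sup>k \<delta>\<close> uniformly,
  and as only boundedly many of their shifts meet a given index, \<open>\<parallel>S\<^sup>k\<parallel> \<le> C\<close> for all \<open>k\<close>.  Therefore
  \<open>sup\<^sub>m \<parallel>S\<^sup>m p\<parallel>\<close> is a norm that is equivalent to the supremum norm and not increased by \<open>S\<close>; each step of
  the perturbed scheme increases it by at most the factor \<open>1 + C \<epsilon>\<^sub>k\<close>, so the perturbed data stay
  bounded.  The same norm shows that \<open>p\<^sup>m\<^sup>+\<^sup>k\<close> differs from \<open>S\<^sup>k p\<^sup>m\<close> by a multiple of \<open>\<Sum>\<^sub>j\<^sub>\<ge>\<^sub>m \<epsilon>\<^sub>j\<close>,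
  uniformly in \<open>k\<close>.  As the curves of \<open>S\<^sup>k p\<^sup>m\<close> converge uniformly in \<open>k\<close>, those of \<open>p\<^sup>m\<^sup>+\<^sup>k\<close> are
  uniformly Cauchy.\<close>

section \<open>The linear scheme\<close>

lemma finite_mask_row:
  fixes a :: "int \<Rightarrow> real"
  assumes "finite {i. a i \<noteq> 0}"
  shows "finite {j. a (i - 2 * j) \<noteq> 0}" "card {j. a (i - 2 * j) \<noteq> 0} \<le> card {i. a i \<noteq> 0}"
proof -
  let ?g = "\<lambda>j. i - 2 * j"
  have sub: "?g ` {j. a (?g j) \<noteq> 0} \<subseteq> {i. a i \<noteq> 0}" by auto
  have inj: "inj_on ?g {j. a (?g j) \<noteq> 0}" by (auto simp: inj_on_def)
  show "finite {j. a (i - 2 * j) \<noteq> 0}"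
    using finite_imageD[OF finite_subset[OF sub assms] inj] .
  show "card {j. a (i - 2 * j) \<noteq> 0} \<le> card {i. a i \<noteq> 0}"
    using card_inj_on_le[OF inj sub assms] .
qed

lemma mask_row_abs_sum_le:
  fixes a :: "int \<Rightarrow> real"
  assumes "finite {i. a i \<noteq> 0}"
  shows "(\<Sum>j | a (i - 2 * j) \<noteq> 0. \<bar>a (i - 2 * j)\<bar>) \<le> (\<Sum>i | a i \<noteq> 0. \<bar>a i\<bar>)"
proof -
  let ?g = "\<lambda>j. i - 2 * j"
  have "(\<Sum>j | a (?g j) \<noteq> 0. \<bar>a (?g j)\<bar>) = (\<Sum>m \<in> ?g ` {j. a (?g j) \<noteq> 0}. \<bar>a m\<bar>)"
    by (rule sum.reindex_cong[symmetric, where l = ?g]) (auto simp: inj_on_def)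
  also have "\<dots> \<le> (\<Sum>i | a i \<noteq> 0. \<bar>a i\<bar>)"
    by (rule sum_mono2) (use assms in auto)
  finally show ?thesis .
qed

lemma mask_support_bound:
  fixes a :: "int \<Rightarrow> real"
  assumes "finite {i. a i \<noteq> 0}"
  obtains N :: nat where "\<And>i. a i \<noteq> 0 \<Longrightarrow> \<bar>i\<bar> \<le> int N"
proof
  fix i assume "a i \<noteq> 0"
  then have "nat \<bar>i\<bar> \<le> Max ((\<lambda>i. nat \<bar>i\<bar>) ` {i. a i \<noteq> 0})"
    using assms by (intro Max_ge) auto
  then show "\<bar>i\<bar> \<le> int (Max ((\<lambda>i. nat \<bar>i\<bar>) ` {i. a i \<noteq> 0}))"
    by linarith
qed

section \<open>Linearity, shifts and crude growth of refinement and its iterates\<close>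

lemma subdiv_scaleR_left: "subdiv a (\<lambda>i. d i *\<^sub>R v) = (\<lambda>i. subdiv a d i *\<^sub>R v)"
  by (simp add: subdiv_def fun_eq_iff scaleR_sum_left)

lemma subdiv_diff: "subdiv a (\<lambda>i. p i - q i) = (\<lambda>i. subdiv a p i - subdiv a q i)"
  by (simp add: subdiv_def fun_eq_iff scaleR_diff_right sum_subtractf)

lemma subdiv_sum: "subdiv a (\<lambda>i. \<Sum>j\<in>J. f j i) = (\<lambda>i. \<Sum>j\<in>J. subdiv a (f j) i)"
  by (auto simp: subdiv_def fun_eq_iff scaleR_sum_right intro: sum.swap)

lemma subdiv_shift: "subdiv a (\<lambda>i. p (i - m)) = (\<lambda>i. subdiv a p (i - 2 * m))"
  unfolding subdiv_def fun_eq_iff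
  by (intro allI sum.reindex_bij_witness[of _ "\<lambda>j. j + m" "\<lambda>j. j - m"])
     (auto simp: algebra_simps)

lemma norm_subdiv_le:
  assumes "finite {i. a i \<noteq> 0}" "\<And>j. norm (p j) \<le> B"
  shows "norm (subdiv a p i) \<le> (\<Sum>i | a i \<noteq> 0. \<bar>a i\<bar>) * B"
proof -
  have "0 \<le> B" using norm_ge_zero assms(2) order_trans by blast
  have "norm (subdiv a p i) \<le> (\<Sum>j | a (i - 2 * j) \<noteq> 0. \<bar>a (i - 2 * j)\<bar> * B)"
    unfolding subdiv_def
    by (rule sum_norm_le) (auto intro!: mult_left_mono assms(2))
  also have "\<dots> \<le> (\<Sum>i | a i \<noteq> 0. \<bar>a i\<bar>) * B"
    using mask_row_abs_sum_le[OF assms(1)] \<open>0 \<le> B\<close>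
    by (simp add: mult_right_mono flip: sum_distrib_right)
  finally show ?thesis .
qed

lemma scheme_points_const: "scheme_points (\<lambda>k. T) p k = (T ^^ k) p"
  by (induction k) auto

lemma subdiv_iter_scaleR_left:
  "(subdiv a ^^ k) (\<lambda>i. d i *\<^sub>R v) = (\<lambda>i. (subdiv a ^^ k) d i *\<^sub>R v)"
  by (induction k) (auto simp: subdiv_scaleR_left)

lemma subdiv_iter_diff:
  "(subdiv a ^^ k) (\<lambda>i. p i - q i) = (\<lambda>i. (subdiv a ^^ k) p i - (subdiv a ^^ k) q i)"
  by (induction k) (auto simp: subdiv_diff)

lemma subdiv_iter_sum:
  "(subdiv a ^^ k) (\<lambda>i. \<Sum>j\<in>J. f j i) = (\<lambda>i. \<Sum>j\<in>J. (subdiv a ^^ k) (f j) i)"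
  by (induction k) (auto simp: subdiv_sum)

text \<open>Every refinement doubles the index scale. Together with linearity this expresses the
  \<open>k\<close>-th refinement of any data through shifts of the single sequence obtained from a
  delta.\<close>

lemma subdiv_iter_shift:
  "(subdiv a ^^ k) (\<lambda>i. p (i - m)) = (\<lambda>i. (subdiv a ^^ k) p (i - 2 ^ k * m))"
  by (induction k) (auto simp: subdiv_shift mult.assoc)

lemma norm_subdiv_iter_le:
  assumes "finite {i. a i \<noteq> 0}" "\<And>j. norm (p j) \<le> B"
  shows "norm ((subdiv a ^^ k) p i) \<le> (\<Sum>i | a i \<noteq> 0. \<bar>a i\<bar>) ^ k * B"
proof (induction k arbitrary: i)
  case (Suc k)
  show ?case
    using norm_subdiv_le[OF assms(1) Suc.IH] by (simp add: mult.assoc)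
qed (use assms in auto)

text \<open>One step reaches indices at distance \<open>N\<close>, and the reach of the remaining
  \<open>k\<close> steps is doubled on the finer grid: \<open>N + 2 * (N * (2 ^ k - 1))\<close>
  equals \<open>N * (2 ^ Suc k - 1)\<close>.\<close>

lemma subdiv_iter_local:
  assumes N: "\<And>i. a i \<noteq> 0 \<Longrightarrow> \<bar>i\<bar> \<le> N"
    and "\<And>l. \<bar>i - 2 ^ k * l\<bar> \<le> N * (2 ^ k - 1) \<Longrightarrow> p l = q l"
  shows "(subdiv a ^^ k) p i = (subdiv a ^^ k) q i"
  using assms(2)
proof (induction k arbitrary: i)
  case (Suc k)
  have "(subdiv a ^^ k) p j = (subdiv a ^^ k) q j" if j: "a (i - 2 * j) \<noteq> 0" for j
  proof (rule Suc.IH)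
    fix l assume l: "\<bar>j - 2 ^ k * l\<bar> \<le> N * (2 ^ k - 1)"
    have abs_le: "\<bar>x + 2 * y\<bar> \<le> n + 2 * m" if "\<bar>x\<bar> \<le> n" "\<bar>y\<bar> \<le> m" for x y n m :: int
      using that by linarith
    have "i - 2 ^ Suc k * l = (i - 2 * j) + 2 * (j - 2 ^ k * l)" by simp
    also have "\<bar>\<dots>\<bar> \<le> N + 2 * (N * (2 ^ k - 1))" by (rule abs_le[OF N[OF j] l])
    also have "\<dots> = N * (2 ^ Suc k - 1)" by (simp add: algebra_simps)
    finally show "p l = q l" by (rule Suc.prems)
  qed
  then show ?case by (simp add: subdiv_def[of a "(subdiv a ^^ k) _"])
qed auto

text \<open>The point is that the bound is independent of \<open>c\<close>. With
  \<open>c = 2 ^ k\<close> it limits, uniformly in the level, how many shifted basis sequences reach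
  a given index. The upper end \<open>i div c + N + 1\<close> absorbs the remainder of
  \<open>i\<close> modulo \<open>c\<close>.\<close>

lemma card_int_mult_close_le:
  fixes c N i :: int
  assumes "0 < c" "0 \<le> N"
  shows "finite {j. \<bar>i - c * j\<bar> \<le> N * c}" "card {j. \<bar>i - c * j\<bar> \<le> N * c} \<le> nat (2 * N + 2)"
proof -
  have sub: "{j. \<bar>i - c * j\<bar> \<le> N * c} \<subseteq> {i div c - N .. i div c + N + 1}"
  proof
    fix j assume "j \<in> {j. \<bar>i - c * j\<bar> \<le> N * c}"
    then have j: "c * j \<le> i + N * c" "i - N * c \<le> c * j" by auto
    have i: "c * (i div c) + i mod c = i" "0 \<le> i mod c" "i mod c < c" using assms by auto
    have "c * (i div c + N + 1) = c * (i div c) + N * c + c" by (simp add: algebra_simps)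
    then have "c * j < c * (i div c + N + 1)" using j(1) i by linarith
    moreover have "c * (i div c - N) = c * (i div c) - N * c" by (simp add: algebra_simps)
    then have "c * (i div c - N) \<le> c * j" using j(2) i by linarith
    ultimately show "j \<in> {i div c - N .. i div c + N + 1}" using assms(1) by auto
  qed
  show "finite {j. \<bar>i - c * j\<bar> \<le> N * c}" using sub finite_subset by blast
  have "card {j. \<bar>i - c * j\<bar> \<le> N * c} \<le> card {i div c - N .. i div c + N + 1}"
    by (rule card_mono[OF _ sub]) auto
  then show "card {j. \<bar>i - c * j\<bar> \<le> N * c} \<le> nat (2 * N + 2)" by simp
qed

section \<open>Piecewise linear curves\<close>

lemma polyline_knot: "polyline k p (of_int i / 2 ^ k) = p i"
  by (simp add: polyline_def)

lemma polyline_diff: "polyline k p t - polyline k q t = polyline k (\<lambda>i. p i - q i) t"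
  by (simp add: polyline_def algebra_simps)

text \<open>Allows the scheme to be restarted at level \<open>m\<close>: the curves then agree up to
  rescaling the parameter, which does not affect uniform estimates.\<close>

lemma polyline_add: "polyline (m + k) p t = polyline k p (2 ^ m * t)"
  by (simp add: polyline_def power_add mult_ac)

lemma norm_polyline_le:
  assumes "\<And>i. norm (p i) \<le> B"
  shows "norm (polyline k p t) \<le> B"
proof -
  let ?x = "frac (2 ^ k * t)"
  have x: "0 \<le> ?x" "?x \<le> 1" using frac_lt_1[of "2 ^ k * t"] by auto
  have "norm (polyline k p t) \<le> (1 - ?x) * B + ?x * B"
    unfolding polyline_def
    by (rule norm_triangle_le, rule add_mono) (use x assms in \<open>auto intro!: mult_left_mono\<close>)
  then show ?thesis by (simp add: algebra_simps)
qed

text \<open>From some level \<open>K\<close> on, all curves stay within distance 1 of one limit,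
  hence within 2 of the curve at level \<open>K\<close>. The crude geometric bound controls that
  curve and the finitely many earlier levels; evaluation at the knots turns curve bounds into bounds
  on the data.\<close>

lemma subdiv_basis_bounded:
  fixes a :: "int \<Rightarrow> real"
  assumes fin: "finite {i. a i \<noteq> 0}"
    and C0: "C0_convergent (\<lambda>k. subdiv a :: (int \<Rightarrow> 'v::euclidean_space) \<Rightarrow> int \<Rightarrow> 'v)"
  obtains D :: real where "\<And>k i. \<bar>(subdiv a ^^ k) (\<lambda>i. of_bool (i = 0) :: real) i\<bar> \<le> D"
proof -
  define d :: "int \<Rightarrow> real" where "d = (\<lambda>i. of_bool (i = 0))"
  \<comment> \<open>Convergence is assumed for vector data, so the scalar delta is placed along a
    unit vector.\<close>
  obtain v :: 'v where "v \<in> Basis" using nonempty_Basis by blast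
  then have v: "norm v = 1" by simp
  define p where "p = (\<lambda>i. d i *\<^sub>R v)"
  \<comment> \<open>The maximum with 1 makes \<open>A ^ k\<close> increasing in \<open>k\<close>, so
    that \<open>A ^ K\<close> covers all levels below \<open>K\<close>.\<close>
  define A where "A = max 1 (\<Sum>i | a i \<noteq> 0. \<bar>a i\<bar>)"
  have A: "\<bar>(subdiv a ^^ k) d i\<bar> \<le> A ^ k" for k i
  proof -
    have "\<bar>(subdiv a ^^ k) d i\<bar> \<le> (\<Sum>i | a i \<noteq> 0. \<bar>a i\<bar>) ^ k * 1"
      using norm_subdiv_iter_le[OF fin, of d 1 k i] by (auto simp: d_def)
    also have "\<dots> \<le> A ^ k" by (auto simp: A_def intro!: power_mono sum_nonneg)
    finally show ?thesis .
  qed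
  have pk: "norm ((subdiv a ^^ k) p i) = \<bar>(subdiv a ^^ k) d i\<bar>" for k i
    by (simp add: p_def subdiv_iter_scaleR_left v)
  have "bounded (range p)"
    unfolding bounded_iff by (rule exI[of _ 1]) (auto simp: p_def d_def v)
  with C0 obtain f where "uniform_limit UNIV (\<lambda>k. polyline k ((subdiv a ^^ k) p)) f sequentially"
    unfolding C0_convergent_def scheme_points_const by blast
  from uniform_limitD[OF this, of 1]
  obtain K where K: "\<And>k t. k \<ge> K \<Longrightarrow> dist (polyline k ((subdiv a ^^ k) p) t) (f t) < 1"
    by (auto simp: eventually_sequentially)
  have "\<bar>(subdiv a ^^ k) d i\<bar> \<le> A ^ K + 2" for k i
  proof (cases "k \<ge> K")
    case True
    let ?t = "of_int i / 2 ^ k"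
    have "norm (polyline K ((subdiv a ^^ K) p) ?t) \<le> A ^ K"
      by (rule norm_polyline_le) (use A pk in simp)
    moreover have "norm (polyline k ((subdiv a ^^ k) p) ?t) = \<bar>(subdiv a ^^ k) d i\<bar>"
      by (simp add: polyline_knot pk)
    moreover have "norm (polyline k ((subdiv a ^^ k) p) ?t)
        \<le> norm (polyline K ((subdiv a ^^ K) p) ?t)
          + dist (polyline k ((subdiv a ^^ k) p) ?t) (polyline K ((subdiv a ^^ K) p) ?t)"
      unfolding dist_norm by (metis add.commute norm_triangle_sub)
    ultimately show ?thesis
      using dist_triangle2[of "polyline k ((subdiv a ^^ k) p) ?t"
          "polyline K ((subdiv a ^^ K) p) ?t" "f ?t"]
        K[OF True, of ?t] K[OF order_refl, of ?t] by linarith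
  next
    case False
    then have "A ^ k \<le> A ^ K" by (intro power_increasing) (auto simp: A_def)
    with A[of k i] show ?thesis by linarith
  qed
  then show ?thesis using that[of "A ^ K + 2"] unfolding d_def by blast
qed

text \<open>The data are expanded in shifted deltas. At most \<open>2 * N + 2\<close> of them reach
  a given index, each contributing at most \<open>D * B\<close>, so the constant does not depend on
  \<open>k\<close>, unlike in \<open>norm_subdiv_iter_le\<close>.\<close>

lemma subdiv_iter_bounded:
  fixes a :: "int \<Rightarrow> real"
  assumes fin: "finite {i. a i \<noteq> 0}"
    and C0: "C0_convergent (\<lambda>k. subdiv a :: (int \<Rightarrow> 'v::euclidean_space) \<Rightarrow> int \<Rightarrow> 'v)"
  obtains C where "C \<ge> 0"
    "\<And>k (p :: int \<Rightarrow> 'v) B i. (\<And>j. norm (p j) \<le> B) \<Longrightarrow> norm ((subdiv a ^^ k) p i) \<le> C * B"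
proof -
  obtain N :: nat where N: "\<And>i. a i \<noteq> 0 \<Longrightarrow> \<bar>i\<bar> \<le> int N" using mask_support_bound[OF fin] by blast
  obtain D where D: "\<And>k i. \<bar>(subdiv a ^^ k) (\<lambda>i. of_bool (i = 0) :: real) i\<bar> \<le> D"
    using subdiv_basis_bounded[OF fin C0] by blast
  have D0: "0 \<le> D" using D[of 0 0] by simp
  show ?thesis
  proof (rule that[of "real (2 * N + 2) * D"])
    fix k i B and p :: "int \<Rightarrow> 'v" assume B: "\<And>j. norm (p j) \<le> B"
    have B0: "0 \<le> B" using norm_ge_zero B order_trans by blast
    define J where "J = {j. \<bar>i - 2 ^ k * j\<bar> \<le> int N * 2 ^ k}"
    have J: "finite J" "card J \<le> 2 * N + 2"
      using card_int_mult_close_le[of "2 ^ k" "int N" i] by (auto simp: J_def nat_add_distrib nat_mult_distrib)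
    \<comment> \<open>By locality \<open>p\<close> may be cut off outside \<open>J\<close>, which
      leaves a finite expansion. Writing \<open>l - j = 0\<close> makes each summand literally a
      shift of the delta.\<close>
    have "(subdiv a ^^ k) p i = (subdiv a ^^ k) (\<lambda>l. \<Sum>j\<in>J. of_bool (l - j = 0) *\<^sub>R p j) i"
    proof (rule subdiv_iter_local[OF N])
      fix l assume l: "\<bar>i - 2 ^ k * l\<bar> \<le> int N * (2 ^ k - 1)"
      also have "\<dots> \<le> int N * 2 ^ k" by (simp add: mult_left_mono)
      finally have "l \<in> J" by (simp add: J_def)
      have "(\<Sum>j\<in>J. of_bool (l - j = 0) *\<^sub>R p j) = (\<Sum>j\<in>J. if l = j then p j else 0)"
        by (rule sum.cong) auto
      with \<open>l \<in> J\<close> J show "p l = (\<Sum>j\<in>J. of_bool (l - j = 0) *\<^sub>R p j)"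
        by simp
    qed
    also have "\<dots> = (\<Sum>j\<in>J. (subdiv a ^^ k) (\<lambda>i. of_bool (i = 0)) (i - 2 ^ k * j) *\<^sub>R p j)"
      unfolding subdiv_iter_sum subdiv_iter_scaleR_left
        subdiv_iter_shift[of k a "\<lambda>i. of_bool (i = 0)"] ..
    also have "norm \<dots> \<le> (\<Sum>j\<in>J. D * B)"
      by (rule sum_norm_le) (auto intro!: mult_mono D B D0)
    also have "\<dots> \<le> real (2 * N + 2) * (D * B)"
      using J D0 B0 by (auto intro!: mult_right_mono)
    finally show "norm ((subdiv a ^^ k) p i) \<le> real (2 * N + 2) * D * B" by (simp add: mult.assoc)
  qed (use D0 in auto)
qed

section \<open>Summable perturbations\<close>

text \<open>Only the distance to the linear scheme, relative to the size of the data, enters; the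
  operators \<open>T k\<close> may themselves be nonlinear.\<close>

lemma C0_convergent_summable_perturbation:
  fixes a :: "int \<Rightarrow> real" and T :: "nat \<Rightarrow> (int \<Rightarrow> 'v::euclidean_space) \<Rightarrow> int \<Rightarrow> 'v"
  assumes fin: "finite {i. a i \<noteq> 0}"
    and C0: "C0_convergent (\<lambda>k. subdiv a :: (int \<Rightarrow> 'v) \<Rightarrow> int \<Rightarrow> 'v)"
    and pert: "\<And>k p B i. (\<And>j. norm (p j) \<le> B) \<Longrightarrow> norm (T k p i - subdiv a p i) \<le> \<epsilon> k * B"
    and nonneg: "\<And>k. 0 \<le> \<epsilon> k" and "summable \<epsilon>"
  shows "C0_convergent T"
  unfolding C0_convergent_def
proof (intro allI impI)
  fix p0 :: "int \<Rightarrow> 'v" assume "bounded (range p0)"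
  then obtain B where B: "\<And>i. norm (p0 i) \<le> B" by (auto simp: bounded_iff)
  have B0: "0 \<le> B" using norm_ge_zero B order_trans by blast
  obtain C where C0': "0 \<le> C" and C: "\<And>k (p :: int \<Rightarrow> 'v) B i. (\<And>j. norm (p j) \<le> B) \<Longrightarrow>
      norm ((subdiv a ^^ k) p i) \<le> C * B"
    using subdiv_iter_bounded[OF fin C0] by metis
  define p where "p = scheme_points T p0"
  define E where "E = (\<lambda>k i. p (Suc k) i - subdiv a (p k) i)"
  define S where "S = (\<lambda>k. subdiv a ^^ k :: (int \<Rightarrow> 'v) \<Rightarrow> int \<Rightarrow> 'v)"
  have E: "norm (S l (E k) i) \<le> C * (\<epsilon> k * R)" if "\<And>j. norm (p k j) \<le> R" for k i R l
    unfolding S_def by (rule C) (use pert[OF that] in \<open>simp add: E_def p_def\<close>)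
  have step: "S l (p (Suc k)) i = S (Suc l) (p k) i + S l (E k) i" for l k i
    unfolding S_def E_def subdiv_iter_diff by (simp add: funpow_swap1)
  \<comment> \<open>The bound is claimed for all further linear refinements \<open>S l\<close>,
    which amounts to using the norm that \<open>S\<close> does not increase. Thus \<open>C\<close>
    is paid once for the initial data and afterwards only together with \<open>\<epsilon> j\<close>;
    a plain supremum norm estimate could collect a factor at every step.\<close>
  have grow: "norm (S l (p k) i) \<le> C * B * (\<Prod>j<k. 1 + \<epsilon> j * C)" for k l i
  proof (induction k arbitrary: l i)
    case 0
    show ?case using C[OF B] by (simp add: p_def S_def)
  next
    case (Suc k)
    let ?X = "C * B * (\<Prod>j<k. 1 + \<epsilon> j * C)"
    have "norm (p k j) \<le> ?X" for j using Suc.IH[of 0 j] by (simp add: S_def)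
    from E[OF this] have "norm (S l (E k) i) \<le> C * (\<epsilon> k * ?X)" .
    with Suc.IH[of "Suc l" i]
    have "norm (S l (p (Suc k)) i) \<le> ?X + C * (\<epsilon> k * ?X)"
      unfolding step by (rule norm_triangle_mono)
    then show ?case by (simp add: algebra_simps)
  qed
  \<comment> \<open>Comes from \<open>1 + x \<le> exp x\<close>, which bounds the partial products
    by the exponential of the whole series.\<close>
  define R where "R = C * B * exp (suminf \<epsilon> * C)"
  have R0: "0 \<le> R" using C0' B0 by (simp add: R_def)
  have R: "norm (p k i) \<le> R" for k i
  proof -
    have "(\<Prod>j<k. 1 + \<epsilon> j * C) \<le> (\<Prod>j<k. exp (\<epsilon> j * C))"
      by (rule prod_mono) (use nonneg C0' in \<open>auto intro!: add_nonneg_nonneg\<close>)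
    also have "\<dots> = exp ((\<Sum>j<k. \<epsilon> j) * C)" by (simp add: exp_sum sum_distrib_right)
    also have "\<dots> \<le> exp (suminf \<epsilon> * C)"
      using C0' sum_le_suminf[OF \<open>summable \<epsilon>\<close>, of "{..<k}"] nonneg by (auto intro!: mult_right_mono)
    finally have "C * B * (\<Prod>j<k. 1 + \<epsilon> j * C) \<le> R"
      unfolding R_def using C0' B0 by (intro mult_left_mono) auto
    with grow[of 0 k i] show ?thesis by (simp add: S_def)
  qed
  \<comment> \<open>Telescoping: the two evolutions from level \<open>m\<close> differ by the
    one-step defects \<open>E (m + j)\<close>, each carried on by the linear scheme. The extra
    \<open>S l\<close> serves the induction as before.\<close>
  have diff: "norm (S l (\<lambda>i. p (m + k) i - S k (p m) i) i) \<le> C * R * (\<Sum>j<k. \<epsilon> (m + j))" for k l i m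
  proof (induction k arbitrary: l i)
    case 0
    \<comment> \<open>Here the difference is the zero sequence, and the bound \<open>C * 0\<close>
      shows that \<open>S l\<close> keeps it zero.\<close>
    show ?case using C[of "\<lambda>_. 0" 0 l i] by (simp add: S_def)
  next
    case (Suc k)
    have "S l (\<lambda>i. p (m + Suc k) i - S (Suc k) (p m) i) i
        = S (Suc l) (\<lambda>i. p (m + k) i - S k (p m) i) i + S l (E (m + k)) i"
      using step[of l "m + k" i] unfolding S_def subdiv_iter_diff
      by (simp add: funpow_swap1)
    moreover have "norm (S l (E (m + k)) i) \<le> C * (\<epsilon> (m + k) * R)" by (rule E[OF R])
    ultimately have "norm (S l (\<lambda>i. p (m + Suc k) i - S (Suc k) (p m) i) i)
        \<le> C * R * (\<Sum>j<k. \<epsilon> (m + j)) + C * (\<epsilon> (m + k) * R)"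
      using norm_triangle_mono[OF Suc.IH] by simp
    then show ?case by (simp add: algebra_simps)
  qed
  \<comment> \<open>The limit \<open>f\<close> used below belongs to the linear scheme started from
    \<open>p m\<close> and varies with \<open>m\<close>. It therefore serves only to compare late
    curves with each other, and completeness supplies the actual limit. First \<open>m\<close> is
    chosen from the tail of the series, then \<open>K\<close> depending on \<open>m\<close>.\<close>
  have Cauchy: "uniformly_Cauchy_on UNIV (\<lambda>k. polyline k (p k))"
    unfolding uniformly_Cauchy_on_def
  proof (intro allI impI)
    fix e :: real assume "0 < e"
    have "(\<lambda>m. C * R * (\<Sum>j. \<epsilon> (j + m))) \<longlonglongrightarrow> C * R * 0"
      by (intro tendsto_intros suminf_exist_split2 \<open>summable \<epsilon>\<close>)
    then have "\<forall>\<^sub>F m in sequentially. C * R * (\<Sum>j. \<epsilon> (j + m)) < e / 4"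
      using \<open>0 < e\<close> by (intro order_tendstoD(2)[where y = "C * R * 0"]) auto
    then obtain m where m: "C * R * (\<Sum>j. \<epsilon> (j + m)) < e / 4"
      by (auto simp: eventually_sequentially)
    have close: "dist (polyline (m + k) (p (m + k)) t) (polyline (m + k) (S k (p m)) t) < e / 4" for k t
    proof -
      have "(\<Sum>j<k. \<epsilon> (m + j)) \<le> (\<Sum>j. \<epsilon> (j + m))"
        using sum_le_suminf[of "\<lambda>j. \<epsilon> (j + m)" "{..<k}"] nonneg \<open>summable \<epsilon>\<close>
        by (simp add: add.commute summable_iff_shift)
      then have "C * R * (\<Sum>j<k. \<epsilon> (m + j)) \<le> C * R * (\<Sum>j. \<epsilon> (j + m))"
        using C0' R0 by (intro mult_left_mono) auto
      then have "norm (p (m + k) i - S k (p m) i) \<le> C * R * (\<Sum>j. \<epsilon> (j + m))" for i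
        using diff[of 0 m k i] by (simp add: S_def)
      from norm_polyline_le[OF this] m show ?thesis
        unfolding dist_norm polyline_diff by (rule le_less_trans)
    qed
    have "bounded (range (p m))" using R by (auto simp: bounded_iff)
    with C0 obtain f where "uniform_limit UNIV (\<lambda>k. polyline k (S k (p m))) f sequentially"
      unfolding C0_convergent_def scheme_points_const S_def by blast
    from uniform_limitD[OF this, of "e / 4"] \<open>0 < e\<close>
    obtain K where K: "\<And>k t. k \<ge> K \<Longrightarrow> dist (polyline k (S k (p m)) t) (f t) < e / 4"
      by (auto simp: eventually_sequentially)
    have near: "dist (polyline k (p k) t) (f (2 ^ m * t)) < e / 2" if k: "k \<ge> m + K" for k t
    proof -
      obtain k' where k': "k = m + k'" "k' \<ge> K" using k
        by (metis le_add_diff_inverse add_leD1 nat_add_left_cancel_le)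
      show ?thesis
        using K[OF k'(2), of "2 ^ m * t"] close[of k' t]
          dist_triangle[of "polyline k (p k) t" "f (2 ^ m * t)" "polyline k (S k' (p m)) t"]
        unfolding k'(1) polyline_add[of m k' "S k' (p m)"] by linarith
    qed
    show "\<exists>M. \<forall>x\<in>UNIV. \<forall>k\<ge>M. \<forall>n\<ge>M. dist (polyline k (p k) x) (polyline n (p n) x) < e"
    proof (intro exI ballI allI impI)
      fix t k n assume "m + K \<le> k" "m + K \<le> n"
      from near[OF this(1), of t] near[OF this(2), of t]
      show "dist (polyline k (p k) t) (polyline n (p n) t) < e"
        by (rule dist_triangle_half_l)
    qed
  qed
  then have "uniformly_convergent_on UNIV (\<lambda>k. polyline k (p k))"
    by (rule Cauchy_uniformly_convergent)
  then show "\<exists>f. uniform_limit UNIV (\<lambda>k. polyline k (scheme_points T p0 k)) f sequentially"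
    unfolding uniformly_convergent_on_def p_def .
qed

section \<open>The point-normal scheme\<close>

text \<open>Nondegeneracy rules out a zero denominator, for which the normalization would return the
  zero vector.\<close>

lemma norm_normals:
  assumes "\<And>j. norm (n0 j) = 1" "pn_nondegenerate a n0"
  shows "norm (normals a n0 k j) = 1"
proof (cases k)
  case (Suc k')
  obtain \<delta> where "\<delta> > 0" "\<And>k i. norm (subdiv a (normals a n0 k) i) \<ge> \<delta>"
    using assms(2) unfolding pn_nondegenerate_def by blast
  then have "norm (subdiv a (normals a n0 k') j) > 0" using less_le_trans by blast
  then show ?thesis by (simp add: Suc)
qed (use assms in auto)

lemma norm_diff_int_le:
  fixes f :: "int \<Rightarrow> 'v::real_normed_vector"
  assumes "\<And>i. norm (f i - f (i - 1)) \<le> e"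
  shows "norm (f j - f l) \<le> of_int \<bar>j - l\<bar> * e"
proof -
  have *: "norm (f (i + int n) - f i) \<le> real n * e" for i n
  proof (induction n)
    case (Suc n)
    have "norm (f (i + int (Suc n)) - f (i + int n)) \<le> e"
      using assms[of "i + int (Suc n)"] by (simp add: algebra_simps)
    from norm_triangle_mono[OF this Suc.IH] show ?case by (simp add: algebra_simps)
  qed simp
  show ?thesis
  proof (cases "l \<le> j")
    case True
    then show ?thesis using *[of l "nat (j - l)"] by simp
  next
    case False
    then show ?thesis using *[of j "nat (l - j)"] by (simp add: norm_minus_commute)
  qed
qed

text \<open>With \<open>w = v + u\<close> these are entries of two matrices \<open>pn_A\<close> of
  one row, which share the new normal \<open>u\<close>. Over the common denominator the numerator
  splits into two terms of size at most \<open>2 * norm (w - w')\<close>, and the denominator is at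
  least \<open>\<delta>\<^sup>2\<close> in absolute value.\<close>

lemma normalized_component_diff_le:
  fixes w w' u :: "real^'n"
  assumes "norm u \<le> 1" "norm w \<le> 2" "norm w' \<le> 2" "0 < \<delta>" "\<bar>w \<bullet> u\<bar> \<ge> \<delta>" "\<bar>w' \<bullet> u\<bar> \<ge> \<delta>"
  shows "\<bar>u $ r * w $ c / (w \<bullet> u) - u $ r * w' $ c / (w' \<bullet> u)\<bar> \<le> 4 * norm (w - w') / \<delta>\<^sup>2"
proof -
  let ?d = "w \<bullet> u" and ?d' = "w' \<bullet> u"
  have ip: "\<bar>x \<bullet> u\<bar> \<le> norm x" for x
    using order_trans[OF Cauchy_Schwarz_ineq2[of x u]] mult_left_le[OF assms(1), of "norm x"] by simp
  have nz: "?d \<noteq> 0" "?d' \<noteq> 0" using assms by auto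
  have "u $ r * w $ c / ?d - u $ r * w' $ c / ?d'
      = u $ r * ((w - w') $ c * ?d' - w' $ c * ((w - w') \<bullet> u)) / (?d * ?d')"
    using nz by (simp add: field_simps inner_diff_left)
  also have "\<bar>\<dots>\<bar> \<le> 4 * norm (w - w') / \<delta>\<^sup>2"
  proof -
    have "\<bar>(w - w') $ c * ?d' - w' $ c * ((w - w') \<bullet> u)\<bar>
        \<le> \<bar>(w - w') $ c\<bar> * \<bar>?d'\<bar> + \<bar>w' $ c\<bar> * \<bar>(w - w') \<bullet> u\<bar>"
      by (metis abs_mult abs_triangle_ineq4)
    also have "\<dots> \<le> norm (w - w') * 2 + 2 * norm (w - w')"
      by (intro add_mono mult_mono component_le_norm_cart ip order_trans[OF ip assms(3)]
          order_trans[OF component_le_norm_cart assms(3)]) auto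
    finally have "\<bar>u $ r\<bar> * \<bar>(w - w') $ c * ?d' - w' $ c * ((w - w') \<bullet> u)\<bar> \<le> 1 * (4 * norm (w - w'))"
      by (intro mult_mono order_trans[OF component_le_norm_cart assms(1)]) auto
    moreover have "\<delta>\<^sup>2 \<le> \<bar>?d\<bar> * \<bar>?d'\<bar>"
      unfolding power2_eq_square using assms by (intro mult_mono) auto
    ultimately show ?thesis
      unfolding abs_divide abs_mult using \<open>0 < \<delta>\<close> by (intro frac_le) auto
  qed
  finally show ?thesis .
qed

text \<open>\<open>M - I\<close> is a weighted sum of differences of matrices \<open>pn_A\<close>
  within one row. The new normal cancels from their \<open>w - w'\<close>, leaving old normals at
  boundedly distant indices; the absolute weights sum to at most \<open>L\<close>.\<close>

lemma pn_M_component_bound: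
  fixes n0 :: "int \<Rightarrow> real^'n"
  assumes mask: "is_mask a"
    and unit: "\<And>j. norm (n0 j) = 1"
    and nondeg: "pn_nondegenerate a n0"
    and Hoelder: "\<And>i k. norm (normals a n0 k i - normals a n0 k (i - 1)) \<le> \<eta> k"
  obtains K where "K \<ge> 0" "\<And>k i j r c. a (i - 2 * j) \<noteq> 0 \<Longrightarrow>
    \<bar>(pn_M a n0 k i j - mat 1) $ r $ c\<bar> \<le> K * \<eta> k"
proof -
  have fin: "finite {i. a i \<noteq> 0}" using mask by (simp add: is_mask_def)
  obtain N :: nat where N: "\<And>i. a i \<noteq> 0 \<Longrightarrow> \<bar>i\<bar> \<le> int N" using mask_support_bound[OF fin] by blast
  obtain \<delta> where "0 < \<delta>" and \<delta>: "\<And>k i j. a (i - 2 * j) \<noteq> 0 \<Longrightarrow>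
      \<bar>(normals a n0 k j + normals a n0 (Suc k) i) \<bullet> normals a n0 (Suc k) i\<bar> \<ge> \<delta>"
    using nondeg unfolding pn_nondegenerate_def by blast
  define L where "L = (\<Sum>i | a i \<noteq> 0. \<bar>a i\<bar>)"
  define H where "H = 4 * real N / \<delta>\<^sup>2"
  have L0: "0 \<le> L" by (simp add: L_def sum_nonneg)
  have \<eta>0: "0 \<le> \<eta> k" for k using Hoelder norm_ge_zero order_trans by blast
  have A: "\<bar>(pn_A a n0 k i j - pn_A a n0 k i l) $ r $ c\<bar> \<le> H * \<eta> k"
    if jl: "a (i - 2 * j) \<noteq> 0" "a (i - 2 * l) \<noteq> 0" for k i j l r c
  proof -
    let ?u = "normals a n0 (Suc k) i" and ?v = "normals a n0 k"
    have le2: "norm (?v x + ?u) \<le> 2" for x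
      using norm_triangle_ineq[of "?v x" ?u] by (simp only: norm_normals[OF unit nondeg])
    \<comment> \<open>Both \<open>i - 2 * j\<close> and \<open>i - 2 * l\<close> lie within
      \<open>N\<close> of zero, so \<open>2 * (j - l)\<close> is at most \<open>2 * N\<close> in
      absolute value.\<close>
    have "\<bar>j - l\<bar> \<le> int N" using N[OF jl(1)] N[OF jl(2)] by linarith
    then have "real_of_int \<bar>j - l\<bar> * \<eta> k \<le> real N * \<eta> k"
      using \<eta>0 by (intro mult_right_mono) linarith+
    then have v: "norm (?v j - ?v l) \<le> real N * \<eta> k"
      using norm_diff_int_le[of ?v "\<eta> k" j l, OF Hoelder] by linarith
    have "\<bar>(pn_A a n0 k i j - pn_A a n0 k i l) $ r $ c\<bar> \<le> 4 * norm ((?v j + ?u) - (?v l + ?u)) / \<delta>\<^sup>2"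
      using normalized_component_diff_le[of ?u "?v j + ?u" "?v l + ?u" \<delta> r c,
          OF _ le2 le2 \<open>0 < \<delta>\<close> \<delta>[OF jl(1)] \<delta>[OF jl(2)]] norm_normals[OF unit nondeg, of "Suc k" i]
      by (simp only: pn_A_def Let_def vector_minus_component vec_lambda_beta)
    also have "\<dots> \<le> 4 * (real N * \<eta> k) / \<delta>\<^sup>2"
      using v by (intro divide_right_mono) (auto simp del: normals.simps)
    finally show ?thesis by (simp add: H_def)
  qed
  show ?thesis
  proof (rule that[of "L * H"])
    fix k i j r c assume j: "a (i - 2 * j) \<noteq> 0"
    have "(pn_M a n0 k i j - mat 1) $ r $ c
        = (\<Sum>l | a (i - 2 * l) \<noteq> 0. a (i - 2 * l) * (pn_A a n0 k i j - pn_A a n0 k i l) $ r $ c)"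
      by (simp add: pn_M_def)
    also have "\<bar>\<dots>\<bar> \<le> (\<Sum>l | a (i - 2 * l) \<noteq> 0. \<bar>a (i - 2 * l)\<bar> * (H * \<eta> k))"
      by (rule order_trans[OF sum_abs sum_mono]) (auto simp only: abs_mult mem_Collect_eq intro!: mult_left_mono A[OF j] abs_ge_zero)
    also have "\<dots> \<le> L * (H * \<eta> k)"
      unfolding L_def sum_distrib_right[symmetric]
      using \<eta>0 by (intro mult_right_mono mask_row_abs_sum_le[OF fin]) (auto simp: H_def)
    finally show "\<bar>(pn_M a n0 k i j - mat 1) $ r $ c\<bar> \<le> L * H * \<eta> k" by (simp add: mult.assoc)
  qed (use L0 in \<open>simp add: H_def\<close>)
qed

section \<open>From entrywise bounds to asymptotic equivalence\<close>

lemma mat_norm_inf_le: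
  fixes A :: "real^'n^'n"
  assumes "\<And>r c. \<bar>A $ r $ c\<bar> \<le> b"
  shows "mat_norm_inf A \<le> real CARD('n) * b"
  unfolding mat_norm_inf_def
  by (subst Max_le_iff) (auto intro!: sum_bounded_above assms)

text \<open>Each row differs in at most \<open>n\<close> blocks, so its infinite sum collapses to a
  finite one, and the supremum over rows is at most \<open>n * \<epsilon> k\<close>, a summable real
  bound.\<close>

lemma asymp_equivalent_of_bound:
  fixes B :: "nat \<Rightarrow> int \<Rightarrow> int \<Rightarrow> real^'n^'n" and C :: "int \<Rightarrow> int \<Rightarrow> real^'n^'n"
  assumes "\<And>i. finite (J i)" "\<And>i. card (J i) \<le> n"
    and "\<And>k i j. j \<notin> J i \<Longrightarrow> B k i j = C i j"
    and "\<And>k i j. mat_norm_inf (B k i j - C i j) \<le> \<epsilon> k"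
    and "\<And>k. 0 \<le> \<epsilon> k" "summable \<epsilon>"
  shows "asymp_equivalent B C"
proof -
  have zero: "mat_norm_inf (0 :: real^'n^'n) = 0" by (simp add: mat_norm_inf_def)
  have "block_dist (B k) C \<le> ennreal (real n * \<epsilon> k)" for k
    unfolding block_dist_def
  proof (rule SUP_least)
    fix i
    have "(\<Sum>\<^sub>\<infinity>j. ennreal (mat_norm_inf (B k i j - C i j)))
        = (\<Sum>\<^sub>\<infinity>j\<in>J i. ennreal (mat_norm_inf (B k i j - C i j)))"
      by (rule infsum_cong_neutral) (use assms(3) zero in auto)
    also have "\<dots> = (\<Sum>j\<in>J i. ennreal (mat_norm_inf (B k i j - C i j)))"
      by (rule infsum_finite[OF assms(1)])
    also have "\<dots> \<le> (\<Sum>j\<in>J i. ennreal (\<epsilon> k))"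
      by (intro sum_mono ennreal_leI assms)
    also have "\<dots> = ennreal (real (card (J i)) * \<epsilon> k)"
      using assms(5) by (simp add: ennreal_mult ennreal_of_nat_eq_real_of_nat)
    also have "\<dots> \<le> ennreal (real n * \<epsilon> k)"
      using assms(2,5) by (intro ennreal_leI mult_right_mono) auto
    finally show "(\<Sum>\<^sub>\<infinity>j. ennreal (mat_norm_inf (B k i j - C i j))) \<le> ennreal (real n * \<epsilon> k)" .
  qed
  then have "(\<Sum>k. block_dist (B k) C) \<le> (\<Sum>k. ennreal (real n * \<epsilon> k))"
    by (intro suminf_le summableI) auto
  also have "\<dots> < \<infinity>"
    using assms(5,6) by (subst suminf_ennreal2) (auto intro!: summable_mult)
  finally show ?thesis by (simp add: asymp_equivalent_def)
qed

theorem theorem4p1: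
  fixes a :: "int \<Rightarrow> real" and n0 :: "int \<Rightarrow> real^'n"
  assumes dim: "CARD('n) = 2 \<or> CARD('n) = 3"
    and mask: "is_mask a"
    and unit: "\<And>j. norm (n0 j) = 1"
    and nondeg: "pn_nondegenerate a n0"
    and normals_Hoelder: "\<exists>c1 \<alpha> :: real. c1 > 0 \<and> 0 < \<alpha> \<and> \<alpha> \<le> 1 \<and>
          (\<forall>i k. norm (normals a n0 k i - normals a n0 k (i - 1)) < c1 * 2 powr (- real k * \<alpha>))"
    and C0: "C0_convergent (\<lambda>k. subdiv a :: (int \<Rightarrow> real^'n) \<Rightarrow> int \<Rightarrow> real^'n)"
  shows "asymp_equivalent (pn_block a n0) (subdiv_block a) \<and> C0_convergent (pn_refine a n0)"
proof -
  have fin: "finite {i. a i \<noteq> 0}" using mask by (simp add: is_mask_def)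
  obtain c1 \<alpha> :: real where c: "c1 > 0" "0 < \<alpha>" and
    H: "\<And>i k. norm (normals a n0 k i - normals a n0 k (i - 1)) < c1 * 2 powr (- real k * \<alpha>)"
    using normals_Hoelder by blast
  define \<theta> :: real where "\<theta> = 2 powr (- \<alpha>)"
  have \<theta>: "0 < \<theta>" "\<theta> < 1" using c by (auto simp: \<theta>_def powr_less_one)
  have "2 powr (- real k * \<alpha>) = \<theta> ^ k" for k
    by (simp add: \<theta>_def powr_powr mult.commute flip: powr_realpow)
  with H have H': "norm (normals a n0 k i - normals a n0 k (i - 1)) \<le> c1 * \<theta> ^ k" for i k
    by (metis less_imp_le)
  obtain K where K0: "K \<ge> 0" and K: "\<And>k i j r c. a (i - 2 * j) \<noteq> 0 \<Longrightarrow>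
      \<bar>(pn_M a n0 k i j - mat 1) $ r $ c\<bar> \<le> K * (c1 * \<theta> ^ k)"
    using pn_M_component_bound[OF mask unit nondeg H'] by metis
  define L where "L = (\<Sum>i | a i \<noteq> 0. \<bar>a i\<bar>)"
  have L0: "0 \<le> L" by (simp add: L_def sum_nonneg)
  have aL: "\<bar>a i\<bar> \<le> L" for i
  proof (cases "a i = 0")
    case False
    then show ?thesis unfolding L_def using fin by (intro member_le_sum) auto
  qed (use L0 in simp)
  define b where "b = (\<lambda>k. L * (K * (c1 * \<theta> ^ k)))"
  have b0: "0 \<le> b k" for k using L0 K0 c \<theta> by (simp add: b_def)
  have sb: "summable b" unfolding b_def using \<theta> by (intro summable_mult summable_geometric) auto
  \<comment> \<open>Both conclusions are derived from this entrywise bound. Off the mask support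
    \<open>pn_M\<close> is not controlled, but there the weight makes both blocks zero.\<close>
  have blk: "\<bar>(pn_block a n0 k i j - subdiv_block a i j) $ r $ c\<bar> \<le> b k" for k i j r c
  proof (cases "a (i - 2 * j) = 0")
    case False
    have "(pn_block a n0 k i j - subdiv_block a i j) $ r $ c = a (i - 2 * j) * (pn_M a n0 k i j - mat 1) $ r $ c"
      by (simp add: pn_block_def subdiv_block_def algebra_simps)
    also have "\<bar>\<dots>\<bar> \<le> b k"
      unfolding abs_mult b_def by (intro mult_mono aL K[OF False] L0) auto
    finally show ?thesis .
  qed (use b0 in \<open>simp add: pn_block_def subdiv_block_def\<close>)
  let ?m = "real CARD('n)"
  have "asymp_equivalent (pn_block a n0) (subdiv_block a)"
  proof (rule asymp_equivalent_of_bound[where J = "\<lambda>i. {j. a (i - 2 * j) \<noteq> 0}" and \<epsilon> = "\<lambda>k. ?m * b k"])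
    show "mat_norm_inf (pn_block a n0 k i j - subdiv_block a i j) \<le> ?m * b k" for k i j
      by (rule mat_norm_inf_le[OF blk])
  qed (use finite_mask_row[OF fin] b0 sb in \<open>auto simp: pn_block_def subdiv_block_def intro!: summable_mult\<close>)
  \<comment> \<open>Points are measured in the Euclidean norm, not in the maximum norm behind
    \<open>mat_norm_inf\<close>, so the operator bound is taken from the entries again.\<close>
  moreover have "C0_convergent (pn_refine a n0)"
  proof (rule C0_convergent_summable_perturbation[OF fin C0])
    fix k i B and p :: "int \<Rightarrow> real^'n" assume B: "\<And>j. norm (p j) \<le> B"
    have B0: "0 \<le> B" using norm_ge_zero B order_trans by blast
    let ?J = "{j. a (i - 2 * j) \<noteq> 0}"
    have "subdiv a p i = (\<Sum>j\<in>?J. subdiv_block a i j *v p j)"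
      by (simp add: subdiv_def subdiv_block_def scaleR_matrix_vector_assoc[symmetric])
    then have "pn_refine a n0 k p i - subdiv a p i
        = (\<Sum>j\<in>?J. (pn_block a n0 k i j - subdiv_block a i j) *v p j)"
      by (simp add: pn_refine_eq_block[OF mask] sum_subtractf matrix_vector_mult_diff_rdistrib)
    \<comment> \<open>The factor \<open>?m * ?m\<close> is the number of entries of a block, by
      which their common bound is multiplied to bound the Euclidean operator norm.\<close>
    also have "norm \<dots> \<le> (\<Sum>j\<in>?J. ?m * ?m * b k * B)"
    proof (rule sum_norm_le)
      fix j
      let ?X = "pn_block a n0 k i j - subdiv_block a i j"
      have "norm (?X *v p j) \<le> onorm ((*v) ?X) * norm (p j)"
        by (rule onorm[OF matrix_vector_mul_bounded_linear])
      also have "\<dots> \<le> ?m * ?m * b k * B"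
        using B b0 by (intro mult_mono onorm_le_matrix_component blk) auto
      finally show "norm (?X *v p j) \<le> ?m * ?m * b k * B" .
    qed
    also have "\<dots> \<le> real (card {i. a i \<noteq> 0}) * (?m * ?m * b k * B)"
      using finite_mask_row(2)[OF fin, of i] b0 B0 by (auto intro!: mult_right_mono)
    finally show "norm (pn_refine a n0 k p i - subdiv a p i)
        \<le> real (card {i. a i \<noteq> 0}) * (?m * ?m * b k) * B" by (simp add: mult_ac)
  qed (use b0 sb in \<open>auto intro!: summable_mult\<close>)
  ultimately show ?thesis ..
qed

end
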